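(* Let $m\geq 3$ be a fixed integer. The word problem in the Hanoi Towers group $\mathcal{H}_m$ is solvable in subexponential time $\exp(O(\log^{m-2} n))$, where $n$ is the length of the input word over the states of the Hanoi automaton $\mathsf{H}_m$.
   Context: Hanoi Towers group. Let $X_m=\{1,2,\ldots,m\}$ and let $X_m^{*}$ be the set of finite words over $X_m$ (including the empty word). For every transposition $(i,j)$ on $X_m$ let $a_{(ij)}$ be the transformation of $X_m^{*}$ defined recursively by fixing the empty word and $$a_{(ij)}(iv)=jv,\quad a_{(ij)}(jv)=iv,\quad a_{(ij)}(xv)=x\,a_{(ij)}(v)\ \text{ for } x\in X_m\setminus\{i,j\},$$ for all $v\in X_m^{*}$; that is, $a_{(ij)}$ changes the first occurrence of a letter $i$ or $j$ to the other one and leaves all other letters unchanged. Let $e$ denote the identity transformation. The Hanoi Towers group $\mathcal{H}_m$ is the group generated by all $a_{(ij)}$ under composition of functions. The states of the Hanoi automaton $\mathsf{H}_m$ are $e$ and the $a_{(ij)}$; they form a finite symmetric generating set of $\mathcal{H}_m$ (each $a_{(ij)}$ is an involution), so every element of $\mathcal{H}_m$ is given by a word $s_1s_2\ldots s_n$ over these states, acting by composition as a left action: $(s_1s_2\ldots s_n)(v)=s_1(s_2(\cdots s_n(v)\cdots))$. Word problem. Given a word $s_1s_2\ldots s_n$ over the states of $\mathsf{H}_m$, decide whether it defines the trivial transformation of $X_m^{*}$, i.e. whether it represents the identity of $\mathcal{H}_m$. "Solvable in time $\exp(O(\log^{m-2} n))$" has its usual meaning: there is a deterministic algorithm that decides this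 for every input word of length $n$ with running time at most $\exp(f(n))$, where $f(n)=O(\log^{m-2} n)$ as $n\to\infty$. Here $\log^{m-2} n$ means $(\log n)^{m-2}$, and the constant implied by $O(\cdot)$ may depend on $m$. *)

theory Defs
  imports
    Complex_Main
    "HOL-Library.Landau_Symbols"
    "HOL-Algebra.Bij"
    "HOL-Algebra.Generated_Groups"
begin

section \<open>The Hanoi Towers group\<close>

definition hanoi_words :: "nat \<Rightarrow> nat list set" where
  "hanoi_words m = lists {1..m}"

fun swap_first :: "nat \<Rightarrow> nat \<Rightarrow> nat list \<Rightarrow> nat list" where
  "swap_first i j [] = []"
| "swap_first i j (x # v) =
    (if x = i then j # v else if x = j then i # v else x # swap_first i j v)"

datatype hanoi_state = Ident | Transp nat nat

text \<open>A transposition is an unordered pair, so each one is listed once, with the smaller letter first.\<close>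

definition hanoi_states :: "nat \<Rightarrow> hanoi_state set" where
  "hanoi_states m = insert Ident {Transp i j | i j. 1 \<le> i \<and> i < j \<and> j \<le> m}"

fun hanoi_action :: "hanoi_state \<Rightarrow> nat list \<Rightarrow> nat list" where
  "hanoi_action Ident v = v"
| "hanoi_action (Transp i j) v = swap_first i j v"

text \<open>Elements of \<open>BijGroup S\<close> are extensional, so a transformation of \<open>nat list\<close> has to be
  restricted to \<open>hanoi_words m\<close>.\<close>

definition hanoi_elem :: "nat \<Rightarrow> hanoi_state \<Rightarrow> (nat list \<Rightarrow> nat list)" where
  "hanoi_elem m s = restrict (hanoi_action s) (hanoi_words m)"

definition hanoi_group :: "nat \<Rightarrow> (nat list \<Rightarrow> nat list) monoid" where
  "hanoi_group m = (BijGroup (hanoi_words m))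
     \<lparr>carrier := generate (BijGroup (hanoi_words m))
        {hanoi_elem m (Transp i j) | i j. 1 \<le> i \<and> i < j \<and> j \<le> m}\<rparr>"


section \<open>The word problem\<close>

definition word_value :: "('g, 'b) monoid_scheme \<Rightarrow> ('s \<Rightarrow> 'g) \<Rightarrow> 's list \<Rightarrow> 'g" where
  "word_value G g w = foldr (\<lambda>s x. g s \<otimes>\<^bsub>G\<^esub> x) w \<one>\<^bsub>G\<^esub>"

definition word_problem :: "('g, 'b) monoid_scheme \<Rightarrow> 's set \<Rightarrow> ('s \<Rightarrow> 'g) \<Rightarrow> 's list set" where
  "word_problem G S g = {w \<in> lists S. word_value G g w = \<one>\<^bsub>G\<^esub>}"

definition hanoi_word_problem :: "nat \<Rightarrow> hanoi_state list set" where
  "hanoi_word_problem m = word_problem (hanoi_group m) (hanoi_states m) (hanoi_elem m)"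


section \<open>Multitape Turing machines and running time\<close>

datatype 's symbol = Blank | Input 's | Aux nat

datatype direction = MoveLeft | Stay | MoveRight

text \<open>Tapes are two-way infinite and are stored relative to the head: cell \<open>0\<close> is the scanned cell,
  and moving the head shifts the content.\<close>

type_synonym 's tape = "int \<Rightarrow> 's symbol"

fun move :: "direction \<Rightarrow> 's tape \<Rightarrow> 's tape" where
  "move MoveLeft t = (\<lambda>i. t (i - 1))"
| "move Stay t = t"
| "move MoveRight t = (\<lambda>i. t (i + 1))"

record ('q, 's) turing_machine =
  tapes :: nat
  states :: "'q set"
  alphabet :: "'s symbol set"
  start :: 'q
  accept :: 'q
  reject :: 'q
  trans :: "'q \<Rightarrow> 's symbol list \<Rightarrow> 'q \<times> ('s symbol \<times> direction) list"

definition turing_machine_over :: "'s set \<Rightarrow> ('q, 's) turing_machine \<Rightarrow> bool" where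
  "turing_machine_over S M \<longleftrightarrow>
     tapes M \<ge> 1 \<and> finite (states M) \<and> finite (alphabet M) \<and>
     Blank \<in> alphabet M \<and> Input ` S \<subseteq> alphabet M \<and>
     start M \<in> states M \<and> accept M \<in> states M \<and> reject M \<in> states M \<and> accept M \<noteq> reject M \<and>
     (\<forall>q \<in> states M. \<forall>r \<in> lists (alphabet M). length r = tapes M \<longrightarrow>
        (case trans M q r of (q', acts) \<Rightarrow>
           q' \<in> states M \<and> length acts = tapes M \<and> acts \<in> lists (alphabet M \<times> UNIV)))"

text \<open>One step: scan cell \<open>0\<close> of every tape, write a symbol to it, and move the head. Configurations
  in the accepting or the rejecting state are halted and do not change any more.\<close>

definition tm_step ::
  "('q, 's) turing_machine \<Rightarrow> 'q \<times> 's tape list \<Rightarrow> 'q \<times> 's tape list" where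
  "tm_step M c = (case c of (q, ts) \<Rightarrow>
     if q = accept M \<or> q = reject M then (q, ts)
     else case trans M q (map (\<lambda>t. t 0) ts) of (q', acts) \<Rightarrow>
       (q', map2 (\<lambda>(a, d) t. move d (t(0 := a))) acts ts))"

definition input_tape :: "'s list \<Rightarrow> 's tape" where
  "input_tape w = (\<lambda>i. if 0 \<le> i \<and> i < int (length w) then Input (w ! nat i) else Blank)"

definition tm_init :: "('q, 's) turing_machine \<Rightarrow> 's list \<Rightarrow> 'q \<times> 's tape list" where
  "tm_init M w = (start M, input_tape w # replicate (tapes M - 1) (\<lambda>_. Blank))"

definition decides_in_time ::
  "('q, 's) turing_machine \<Rightarrow> 's set \<Rightarrow> 's list set \<Rightarrow> (nat \<Rightarrow> real) \<Rightarrow> bool" where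
  "decides_in_time M S L T \<longleftrightarrow>
     turing_machine_over S M \<and>
     (\<forall>w \<in> lists S. \<exists>t::nat. real t \<le> T (length w) \<and>
        fst ((tm_step M ^^ t) (tm_init M w)) = (if w \<in> L then accept M else reject M))"


section \<open>The word problem in terms of the action on words\<close>

lemma swap_first_involution: "swap_first i j (swap_first i j v) = v"
  by (induction v) auto

lemma swap_first_in_words:
  assumes "v \<in> hanoi_words m" "i \<in> {1..m}" "j \<in> {1..m}"
  shows "swap_first i j v \<in> hanoi_words m"
  using assms by (induction v) (auto simp: hanoi_words_def)

lemma hanoi_action_involution: "hanoi_action s (hanoi_action s v) = v"
  by (cases s) (auto simp: swap_first_involution)

lemma hanoi_action_in_words:
  assumes "s \<in> hanoi_states m" "v \<in> hanoi_words m"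
  shows "hanoi_action s v \<in> hanoi_words m"
  using assms swap_first_in_words by (cases s) (auto simp: hanoi_states_def)

lemma hanoi_elem_in_Bij:
  assumes "s \<in> hanoi_states m"
  shows "hanoi_elem m s \<in> Bij (hanoi_words m)"
proof -
  have "bij_betw (hanoi_action s) (hanoi_words m) (hanoi_words m)"
    by (rule bij_betw_byWitness[where f' = "hanoi_action s"])
       (use assms hanoi_action_in_words in \<open>auto simp: hanoi_action_involution\<close>)
  then show ?thesis
    by (simp add: hanoi_elem_def Bij_def)
qed

lemma hanoi_gens_subset:
  "{hanoi_elem m (Transp i j) | i j. 1 \<le> i \<and> i < j \<and> j \<le> m} \<subseteq> carrier (BijGroup (hanoi_words m))"
  using hanoi_elem_in_Bij by (fastforce simp: BijGroup_def hanoi_states_def)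

lemma group_hanoi_group: "group (hanoi_group m)"
  unfolding hanoi_group_def
  by (intro group.subgroup_imp_group group_BijGroup group.generate_is_subgroup hanoi_gens_subset)

lemma hanoi_elem_in_carrier:
  assumes "s \<in> hanoi_states m"
  shows "hanoi_elem m s \<in> carrier (hanoi_group m)"
proof (cases s)
  case Ident
  then have "hanoi_elem m s = \<one>\<^bsub>BijGroup (hanoi_words m)\<^esub>"
    by (auto simp: hanoi_elem_def BijGroup_def restrict_def)
  then show ?thesis
    by (simp add: hanoi_group_def generate.one)
next
  case (Transp i j)
  then show ?thesis
    using assms by (auto simp: hanoi_group_def hanoi_states_def intro!: generate.incl)
qed

lemma hanoi_word_value:
  assumes "w \<in> lists (hanoi_states m)"
  shows "word_value (hanoi_group m) (hanoi_elem m) w \<in> Bij (hanoi_words m) \<and>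
         word_value (hanoi_group m) (hanoi_elem m) w = restrict (foldr hanoi_action w) (hanoi_words m)"
  using assms
proof (induction w)
  case Nil
  then show ?case
    using id_Bij[of "hanoi_words m"]
    by (simp add: word_value_def hanoi_group_def BijGroup_def id_def restrict_def)
next
  case (Cons s w)
  let ?g = "word_value (hanoi_group m) (hanoi_elem m)"
  have s: "s \<in> hanoi_states m" and IH: "?g w \<in> Bij (hanoi_words m)"
    "?g w = restrict (foldr hanoi_action w) (hanoi_words m)"
    using Cons by auto
  have step: "?g (s # w) = compose (hanoi_words m) (hanoi_elem m s) (?g w)"
    using IH(1) hanoi_elem_in_Bij[OF s]
    by (simp add: word_value_def hanoi_group_def BijGroup_def)
  have in_words: "foldr hanoi_action w v \<in> hanoi_words m" if "v \<in> hanoi_words m" for v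
    using Bij_imp_funcset[OF IH(1)] IH(2) that by (metis PiE restrict_apply')
  have "?g (s # w) = restrict (foldr hanoi_action (s # w)) (hanoi_words m)"
    unfolding step IH(2) using in_words
    by (auto simp: compose_def hanoi_elem_def fun_eq_iff restrict_def)
  then show ?case
    using step compose_Bij[OF hanoi_elem_in_Bij[OF s] IH(1)] by metis
qed

lemma hanoi_word_problem_iff:
  "w \<in> hanoi_word_problem m \<longleftrightarrow>
     w \<in> lists (hanoi_states m) \<and> (\<forall>v \<in> hanoi_words m. foldr hanoi_action w v = v)"
proof -
  have "\<one>\<^bsub>hanoi_group m\<^esub> = restrict (\<lambda>v. v) (hanoi_words m)"
    by (simp add: hanoi_group_def BijGroup_def)
  then have "w \<in> hanoi_word_problem m \<longleftrightarrow> w \<in> lists (hanoi_states m) \<and>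
      restrict (foldr hanoi_action w) (hanoi_words m) = restrict (\<lambda>v. v) (hanoi_words m)"
    unfolding hanoi_word_problem_def word_problem_def
    using hanoi_word_value[of w m] by (cases "w \<in> lists (hanoi_states m)") simp_all
  also have "\<dots> \<longleftrightarrow>
      w \<in> lists (hanoi_states m) \<and> (\<forall>v \<in> hanoi_words m. foldr hanoi_action w v = v)"
    by (metis restrict_apply' restrict_ext)
  finally show ?thesis .
qed

end

theory Submission
  imports Defs "HOL-Library.Countable"
begin

text \<open>
  A letter string \<open>v = x\<^sub>1 x\<^sub>2 \<dots>\<close> is a position of the Hanoi game on \<open>m\<close> pegs: disk \<open>k\<close> (disk 1 being
  the smallest) sits on peg \<open>x\<^sub>k\<close>, and \<open>Transp i j\<close> moves the smallest disk found on the pegs \<open>i\<close>, \<open>j\<close> to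
  the other one. Applying a group word \<open>w\<close> of length \<open>n\<close> thus plays \<open>n\<close> moves, the last letter of
  \<open>w\<close> first; let \<open>u = rev w\<close>. Once disk 1 has been placed on \<open>x\<close>, the remaining disks see the word
  \<open>section_word u x\<close>, in which every letter that was spent on disk 1 is replaced by \<open>Ident\<close>.

  Suppose \<open>w\<close> displaces some disk of \<open>v\<close>. A disk that is never moved blocks no move that takes place,
  so deleting it from \<open>v\<close> does not change how the other disks travel. Hence there is also such a \<open>v\<close>
  all of whose disks are moved at least once, and whether \<open>w\<close> is trivial can be found out by examining
  only such \<open>v\<close>.

  The number of disks that \<open>n < 2 ^ r\<close> moves can touch is at most \<open>(3 * r) ^ (m - 2)\<close>
  (\<open>moved_disks_bound\<close>). This is a form of Szegedy's lower bound for the Hanoi game with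
  several pegs. It is proved by induction on the number of pegs and on \<open>r\<close>. Split the disks into
  small ones and a block of big ones, and cut the game at the first moment when all small disks have
  been moved. If all of them are moved again afterwards, one of the two parts has fewer than
  \<open>2 ^ (r - 1)\<close> moves and bounds the number of small disks. Otherwise a small disk rests during the
  second part, and, by the choice of the moment, one rests during the first part up to its last
  move. A resting disk forbids its peg to all bigger disks, so each part moves only as many big
  disks as is possible on one peg fewer.

  The algorithm explores the tree whose nodes are the iterated sections of the word and whose edges
  are the letters \<open>x\<close> with \<open>section_word u x \<noteq> u\<close>. A path in it lists disks that are all moved, so with
  \<open>D = O((ln n) ^ (m - 2))\<close> bounding their number the tree has at most \<open>(m + 1) ^ D\<close>
  nodes, without the machine ever computing \<open>D\<close>. The word is trivial iff at each node every disk
  returns to its peg (\<open>fixes_words_iff\<close>). A machine with two tapes, one serving as a stack of words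
  still to be examined and one holding the current word, spends \<open>O(m n)\<close> steps per node
  (\<open>settles_word\<close>, \<open>settles_bounded_depth\<close>).
\<close>


section \<open>Disks and pegs\<close>

fun peg_move :: "hanoi_state \<Rightarrow> nat \<Rightarrow> nat" where
  "peg_move Ident p = p"
| "peg_move (Transp i j) p = (if p = i then j else if p = j then i else p)"

fun touches :: "hanoi_state \<Rightarrow> nat \<Rightarrow> bool" where
  "touches Ident p = False"
| "touches (Transp i j) p = (p = i \<or> p = j)"

definition residual :: "hanoi_state \<Rightarrow> nat \<Rightarrow> hanoi_state" where
  "residual s p = (if touches s p then Ident else s)"

text \<open>Words over the states are read from left to right in time order here: the head of the list
  acts first, so a group word enters reversed. The length is kept constant, spent letters being
  turned into \<open>Ident\<close>; this makes ``some letter touches the disk'' the same as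
  \<open>section_word u x \<noteq> u\<close>, and gives all words handled by the machine the same length.\<close>

fun section_word :: "hanoi_state list \<Rightarrow> nat \<Rightarrow> hanoi_state list" where
  "section_word [] p = []"
| "section_word (s # u) p = residual s p # section_word u (peg_move s p)"

lemma peg_move_involution [simp]: "peg_move s (peg_move s p) = p"
  by (cases s) auto

lemma touches_peg_move [simp]: "touches s (peg_move s p) = touches s p"
  by (cases s) auto

lemma residual_peg_move [simp]: "residual s (peg_move s p) = residual s p"
  by (simp add: residual_def)

lemma peg_move_untouched: "\<not> touches s p \<Longrightarrow> peg_move s p = p"
  by (cases s) auto

lemma residual_eq_iff: "residual s p = s \<longleftrightarrow> \<not> touches s p"
  by (auto simp: residual_def)

lemma length_section_word [simp]: "length (section_word u p) = length u"
  by (induction u arbitrary: p) auto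

lemma length_foldl_section_word [simp]: "length (foldl section_word u v) = length u"
  by (induction v arbitrary: u) auto

lemma section_word_append:
  "section_word (u @ u') p = section_word u p @ section_word u' (fold peg_move u p)"
  by (induction u arbitrary: p) auto

lemma hanoi_action_Cons: "hanoi_action s (x # v) = peg_move s x # hanoi_action (residual s x) v"
  by (cases s) (auto simp: residual_def)

text \<open>Wreath recursion: this is what reduces the action on positions to the travel of single
  disks.\<close>

lemma fold_hanoi_action_Cons:
  "fold hanoi_action u (x # v) = fold peg_move u x # fold hanoi_action (section_word u x) v"
  by (induction u arbitrary: x v) (auto simp: hanoi_action_Cons)

lemma fold_hanoi_action_Nil [simp]: "fold hanoi_action u [] = []"
proof (induction u)
  case (Cons s u)
  then show ?case by (cases s) auto
qed simp

lemma length_fold_hanoi_action [simp]: "length (fold hanoi_action u v) = length v"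
  by (induction v arbitrary: u) (auto simp: fold_hanoi_action_Cons)

text \<open>The disks in \<open>v\<close> are passed one by one by \<open>foldl section_word u v\<close>, which is the word
  left over for the disks bigger than those in \<open>v\<close>. Cutting time into two phases cuts this left-over
  word accordingly, the second phase starting in the position reached by the first.\<close>

lemma foldl_section_word_append:
  "foldl section_word (u @ u') v =
     foldl section_word u v @ foldl section_word u' (fold hanoi_action u v)"
  by (induction v arbitrary: u u') (auto simp: section_word_append fold_hanoi_action_Cons)

lemma set_section_word: "set (section_word u x) \<subseteq> insert Ident (set u)"
  by (induction u arbitrary: x) (auto simp: residual_def)

lemma set_foldl_section_word: "set (foldl section_word u v) \<subseteq> insert Ident (set u)"
proof (induction v arbitrary: u)
  case (Cons x v)
  show ?case
    using Cons[of "section_word u x"] set_section_word[of u x] by auto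
qed auto

lemma section_word_eq_self_iff: "section_word u x = u \<longleftrightarrow> (\<forall>s \<in> set u. \<not> touches s x)"
  by (induction u) (auto simp: residual_eq_iff peg_move_untouched)


section \<open>The number of disks moved by a short word\<close>

text \<open>The number of disks in a position that are touched at least once; \<open>moved u v = length v\<close>
  says that all of them are.\<close>

fun moved :: "hanoi_state list \<Rightarrow> nat list \<Rightarrow> nat" where
  "moved u [] = 0"
| "moved u (x # v) = (if section_word u x = u then 0 else 1) + moved (section_word u x) v"

lemma moved_le_length: "moved u v \<le> length v"
proof (induction v arbitrary: u)
  case (Cons x v)
  show ?case using Cons[of "section_word u x"] by auto
qed simp

lemma moved_append: "moved u (v @ v') = moved u v + moved (foldl section_word u v) v'"
  by (induction v arbitrary: u) auto

lemma moved_subadditive: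
  "moved (u @ u') v \<le> moved u v + moved u' (fold hanoi_action u v)"
proof (induction v arbitrary: u u')
  case (Cons x v)
  show ?case
    using Cons[of "section_word u x" "section_word u' (fold peg_move u x)"]
    by (auto simp: section_word_append fold_hanoi_action_Cons)
qed simp

lemma moved_only_Ident: "set u \<subseteq> {Ident} \<Longrightarrow> moved u v = 0"
proof (induction v)
  case (Cons x v)
  have "section_word u x = u"
    using Cons.prems by (auto simp: section_word_eq_self_iff)
  then show ?case
    using Cons by simp
qed simp

text \<open>Resting disks can be deleted from the position without affecting the others.\<close>

lemma ex_all_moved: "\<exists>v'. moved u v' = length v' \<and> length v' = moved u v"
proof (induction v arbitrary: u)
  case (Cons x v)
  obtain v' where v': "moved (section_word u x) v' = length v'"
      "length v' = moved (section_word u x) v"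
    using Cons by blast
  show ?case
  proof (cases "section_word u x = u")
    case True
    then show ?thesis using v' by (intro exI[of _ v']) simp
  next
    case False
    then show ?thesis using v' by (intro exI[of _ "x # v'"]) simp
  qed
qed simp

definition moves_on :: "nat set \<Rightarrow> hanoi_state set" where
  "moves_on P = insert Ident {Transp i j | i j. i \<in> P \<and> j \<in> P \<and> i \<noteq> j}"

lemma Ident_in_moves_on [simp]: "Ident \<in> moves_on P"
  by (simp add: moves_on_def)

lemma touches_in_pegs: "s \<in> moves_on P \<Longrightarrow> touches s p \<Longrightarrow> p \<in> P"
  by (auto simp: moves_on_def)

lemma moves_on_remove_peg: "s \<in> moves_on P \<Longrightarrow> \<not> touches s p \<Longrightarrow> s \<in> moves_on (P - {p})"
  by (auto simp: moves_on_def)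

lemma foldl_section_word_in_moves_on:
  "set u \<subseteq> moves_on P \<Longrightarrow> set (foldl section_word u v) \<subseteq> moves_on P"
  using set_foldl_section_word[of u v] by auto

lemma section_word_in_moves_on:
  "set u \<subseteq> moves_on P \<Longrightarrow> set (section_word u x) \<subseteq> moves_on P"
  using foldl_section_word_in_moves_on[of u P "[x]"] by simp

text \<open>A disk outside \<open>P\<close> is never touched by moves on \<open>P\<close>.\<close>

lemma all_moved_imp_in_pegs:
  "moved u v = length v \<Longrightarrow> set u \<subseteq> moves_on P \<Longrightarrow> set v \<subseteq> P"
proof (induction v arbitrary: u)
  case (Cons x v)
  have ne: "section_word u x \<noteq> u" and rest: "moved (section_word u x) v = length v"
    using Cons.prems(1) moved_le_length[of "section_word u x" v] by (auto split: if_splits)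
  have "x \<in> P"
    using ne Cons.prems(2) touches_in_pegs by (auto simp: section_word_eq_self_iff)
  moreover have "set v \<subseteq> P"
    using Cons.IH[OF rest section_word_in_moves_on[OF Cons.prems(2)]] .
  ultimately show ?case by simp
qed simp

lemma peg_move_in_pegs: "s \<in> moves_on P \<Longrightarrow> p \<in> P \<Longrightarrow> peg_move s p \<in> P"
  by (auto simp: moves_on_def)

lemma fold_hanoi_action_in_pegs:
  "set u \<subseteq> moves_on P \<Longrightarrow> set v \<subseteq> P \<Longrightarrow> set (fold hanoi_action u v) \<subseteq> P"
proof (induction v arbitrary: u)
  case (Cons x v)
  have "fold peg_move u y \<in> P" if "y \<in> P" for y
    using Cons.prems(1) that by (induction u arbitrary: y) (auto simp: peg_move_in_pegs)
  then show ?case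
    using Cons.IH[OF section_word_in_moves_on[OF Cons.prems(1)]] Cons.prems(2)
    by (simp add: fold_hanoi_action_Cons)
qed simp

text \<open>A letter that involves the peg of a resting disk must be spent on a smaller disk, for otherwise
  it would move the resting one.\<close>

lemma unmoved_disk_blocks_peg:
  assumes "moved u v \<noteq> length v"
  shows "\<exists>p \<in> set v. \<forall>s \<in> set (foldl section_word u v). \<not> touches s p"
  using assms
proof (induction v arbitrary: u)
  case (Cons x v)
  show ?case
  proof (cases "section_word u x = u")
    case True
    then have "foldl section_word u (x # v) = foldl section_word u v"
      by simp
    moreover have "\<forall>s \<in> set (foldl section_word u v). \<not> touches s x"
      using True set_foldl_section_word[of u v] by (auto simp: section_word_eq_self_iff)
    ultimately show ?thesis by simp
  next
    case False
    then show ?thesis using Cons by auto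
  qed
qed simp

lemma unmoved_disk_removes_peg:
  assumes "moved u v \<noteq> length v" "set u \<subseteq> moves_on P" "set v \<subseteq> P"
  shows "\<exists>p \<in> P. set (foldl section_word u v) \<subseteq> moves_on (P - {p})"
  using unmoved_disk_blocks_peg[OF assms(1)] foldl_section_word_in_moves_on[OF assms(2)]
    assms(3) moves_on_remove_peg by (meson subset_iff)

text \<open>On two pegs the smallest disk in play takes every move.\<close>

lemma moved_two_pegs:
  assumes "card P = 2" "set u \<subseteq> moves_on P"
  shows "moved u v \<le> 1"
proof -
  obtain v' where v': "moved u v' = length v'" "length v' = moved u v"
    using ex_all_moved by blast
  show ?thesis
  proof (cases v')
    case (Cons x v'')
    have "x \<in> P"
      using all_moved_imp_in_pegs[OF v'(1) assms(2)] Cons by simp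
    have "residual s y = Ident" if "s \<in> moves_on P" "y \<in> P" for s y
      using that assms(1) by (auto simp: moves_on_def residual_def card_2_iff)
    then have "set (section_word u y) \<subseteq> {Ident}" if "y \<in> P" for y
      using that assms(2) by (induction u arbitrary: y) (auto simp: peg_move_in_pegs)
    then have "moved (section_word u x) v'' = 0"
      using \<open>x \<in> P\<close> moved_only_Ident by blast
    then show ?thesis
      using v' Cons by (auto split: if_splits)
  qed (use v' in simp)
qed

lemma single_letter_spent:
  assumes "1 \<le> moved [s] v"
  shows "foldl section_word [s] v = [Ident]"
  using assms
proof (induction v arbitrary: s)
  case (Cons x v)
  have "foldl section_word [Ident] v = [Ident]" for v
    by (induction v) (auto simp: residual_def)
  then show ?case
    using Cons by (auto simp: residual_def)
qed simp

text \<open>The arithmetic behind the recursion for the bound: one more bit of length pays for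
  \<open>2 * (3 * Suc r) ^ k + 1\<close> more disks.\<close>

lemma power_step_bound:
  "(3 * r) ^ Suc k + (2 * (3 * Suc r) ^ k + 1) \<le> (3 * Suc r) ^ Suc k" for r k :: nat
proof -
  have "(3 * r) ^ k \<le> (3 * Suc r) ^ k"
    by (rule power_mono) simp_all
  then have "(3 * r) ^ Suc k \<le> 3 * r * (3 * Suc r) ^ k"
    unfolding power_Suc by (rule mult_le_mono2)
  moreover have "1 \<le> (3 * Suc r) ^ k"
    by simp
  moreover have "(3 * Suc r) ^ Suc k = 3 * r * (3 * Suc r) ^ k + 3 * (3 * Suc r) ^ k"
    by (simp add: algebra_simps)
  ultimately show ?thesis by linarith
qed

text \<open>The big disks form a block of \<open>2 * F + 1\<close> disks, where \<open>F\<close> is the bound for one peg fewer: if a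
  small disk rests in each of two phases that together move the whole block, then one
  phase moves more than \<open>F\<close> disks on one peg fewer, which is impossible.\<close>

theorem moved_disks_bound:
  assumes "card P = k + 2" "set u \<subseteq> moves_on P" "length u < 2 ^ r"
  shows "moved u v \<le> (3 * r) ^ k"
  using assms
proof (induction k arbitrary: P u v r)
  case 0
  then show ?case using moved_two_pegs[of P u v] by simp
next
  case (Suc k)
  note fewer_pegs = Suc.IH
  show ?case
    using Suc.prems
  proof (induction r arbitrary: u v)
    case 0
    then show ?case using moved_only_Ident[of u v] by simp
  next
    case (Suc r)
    note shorter = Suc.IH[OF \<open>card P = Suc k + 2\<close>]
    define F where "F = (3 * Suc r) ^ k"
    have finP: "finite P"
      using Suc.prems(1) card.infinite by fastforce
    have removed: "moved (foldl section_word u' v') b \<le> F"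
      if stuck: "moved u' v' \<noteq> length v'" "set u' \<subseteq> moves_on P" "set v' \<subseteq> P"
        "length u' \<le> length u" for u' v' b
    proof -
      obtain p where p: "p \<in> P" "set (foldl section_word u' v') \<subseteq> moves_on (P - {p})"
        using unmoved_disk_removes_peg[OF stuck(1-3)] by blast
      have "card (P - {p}) = k + 2"
        using p(1) finP Suc.prems(1) by simp
      then show ?thesis
        unfolding F_def
        by (rule fewer_pegs) (use p(2) Suc.prems(3) stuck(4) in auto)
    qed
    obtain v' where all: "moved u v' = length v'" and len: "length v' = moved u v"
      using ex_all_moved by blast
    \<comment> \<open>\<open>S\<close> are the small disks, \<open>B\<close> is the block of big ones; if there are at most
      \<open>2 * F + 1\<close> disks, truncated subtraction makes \<open>S\<close> empty.\<close>
    define K where "K = length v' - (2 * F + 1)"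
    define S where "S = take K v'"
    define B where "B = drop K v'"
    have "length S \<le> (3 * r) ^ Suc k"
    proof (cases "S = []")
      case False
      then have lenB: "length B = 2 * F + 1"
        by (auto simp: S_def B_def K_def)
      have v'_eq: "v' = S @ B"
        by (simp add: S_def B_def)
      have movedS: "moved u S = length S" and movedB: "moved (foldl section_word u S) B = length B"
        using all moved_le_length[of u S] moved_le_length[of "foldl section_word u S" B]
        unfolding v'_eq by (auto simp: moved_append)
      have SP: "set S \<subseteq> P"
        using all_moved_imp_in_pegs[OF movedS Suc.prems(2)] .
      \<comment> \<open>The first moment at which every small disk has been moved; \<open>s\<close> is the move that completes this.\<close>
      define T where "T = (LEAST T. moved (take T u) S = length S)"
      have T: "moved (take T u) S = length S"
        unfolding T_def by (rule LeastI[of _ "length u"]) (simp add: movedS)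
      have T_le: "T \<le> length u"
        unfolding T_def by (rule Least_le) (simp add: movedS)
      have "T \<noteq> 0"
        using T False moved_only_Ident[of "[]" S] by (intro notI) simp
      then obtain t where t: "T = Suc t"
        using not0_implies_Suc by blast
      define u1 where "u1 = take t u"
      define s where "s = u ! t"
      define u2 where "u2 = drop T u"
      define S1 where "S1 = fold hanoi_action u1 S"
      define S2 where "S2 = fold hanoi_action (u1 @ [s]) S"
      have take_T: "take T u = u1 @ [s]"
        using T_le by (simp add: u1_def s_def t take_Suc_conv_app_nth)
      have u_eq: "u = (u1 @ [s]) @ u2"
        unfolding take_T[symmetric] u2_def by simp
      \<comment> \<open>By minimality of \<open>T\<close> some small disk rests during \<open>u1\<close>.\<close>
      have not_yet: "moved u1 S \<noteq> length S"
        using not_less_Least[of t "\<lambda>T. moved (take T u) S = length S"]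
        by (simp add: T_def[symmetric] t u1_def)
      have in_P: "set u1 \<subseteq> moves_on P" "set (u1 @ [s]) \<subseteq> moves_on P" "set u2 \<subseteq> moves_on P"
        using Suc.prems(2) by (subst (asm) u_eq, simp)+
      have S2P: "set S2 \<subseteq> P"
        unfolding S2_def by (rule fold_hanoi_action_in_pegs[OF in_P(2) SP])
      have lens: "length u = length (u1 @ [s]) + length u2"
        by (subst u_eq) simp
      show ?thesis
      proof (cases "moved u2 S2 = length S2")
        case True
        have "length (u1 @ [s]) < 2 ^ r \<or> length u2 < 2 ^ r"
          using Suc.prems(3) lens by auto
        moreover have "length S2 = length S"
          by (simp only: S2_def length_fold_hanoi_action)
        ultimately show ?thesis
          using shorter[OF in_P(2), of S] shorter[OF in_P(3), of S2] True T
          unfolding take_T by metis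
      next
        case False
        \<comment> \<open>The move \<open>s\<close> is spent on a small disk, so it moves no big one.\<close>
        have "1 \<le> moved [s] S1"
          using moved_subadditive[of u1 "[s]" S] T not_yet moved_le_length[of u1 S]
          by (simp add: take_T S1_def)
        then have "foldl section_word [s] S1 = [Ident]"
          by (rule single_letter_spent)
        then have "moved (foldl section_word [s] S1) b = 0" for b
          by (simp add: moved_only_Ident)
        then have "moved (foldl section_word u1 S @ foldl section_word [s] S1) B \<le> F + 0"
          using moved_subadditive[of "foldl section_word u1 S" "foldl section_word [s] S1" B]
            removed[OF not_yet in_P(1) SP, of B] lens by simp
        moreover have "foldl section_word u S =
            (foldl section_word u1 S @ foldl section_word [s] S1) @ foldl section_word u2 S2"
          by (subst u_eq) (simp only: foldl_section_word_append S1_def S2_def)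
        ultimately have "moved (foldl section_word u S) B \<le> F + F"
          using moved_subadditive[of "foldl section_word u1 S @ foldl section_word [s] S1"
              "foldl section_word u2 S2" B] removed[OF False in_P(3) S2P] lens
          by (smt (verit) add_mono add_0_right le_add2 order_trans)
        then show ?thesis
          using movedB lenB by simp
      qed
    qed simp
    moreover have "length v' \<le> length S + (2 * F + 1)"
      by (simp add: S_def K_def)
    ultimately show ?case
      using power_step_bound[of r k] unfolding len F_def by linarith
  qed
qed


section \<open>Tapes as pairs of lists\<close>

definition tape_of :: "'s symbol list \<Rightarrow> 's symbol list \<Rightarrow> 's tape" where
  "tape_of l r = (\<lambda>i. if 0 \<le> i then (if nat i < length r then r ! nat i else Blank)
                       else (if nat (- i - 1) < length l then l ! nat (- i - 1) else Blank))"

text \<open>The left list is read from the head outwards, and the head scans the first entry of the right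
  list. Blanks at the outer ends are invisible, which is why cells erased on the right of the stack
  leave no trace.\<close>

lemma tape_of_snoc_Blank_left [simp]: "tape_of (l @ [Blank]) r = tape_of l r"
  by (auto simp: tape_of_def fun_eq_iff nth_append)

lemma tape_of_snoc_Blank_right [simp]: "tape_of l (r @ [Blank]) = tape_of l r"
  by (auto simp: tape_of_def fun_eq_iff nth_append)

lemma tape_of_Blank_left [simp]: "tape_of [Blank] r = tape_of [] r"
  using tape_of_snoc_Blank_left[of "[]" r] by simp

lemma tape_of_Blank_right [simp]: "tape_of l [Blank] = tape_of l []"
  using tape_of_snoc_Blank_right[of l "[]"] by simp

lemma scan_tape_of [simp]:
  "tape_of l (a # r) 0 = a"
  "tape_of l [] 0 = Blank"
  by (simp_all add: tape_of_def)

lemma write_tape_of [simp]: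
  "(tape_of l (a # r))(0 := b) = tape_of l (b # r)"
  by (auto simp: tape_of_def fun_eq_iff nth_Cons')

lemma write_tape_of_Nil [simp]: "(tape_of l [])(0 := b) = tape_of l [b]"
  using write_tape_of[of l Blank "[]" b] by simp

lemma move_tape_of [simp]:
  "move MoveRight (tape_of l (a # r)) = tape_of (a # l) r"
  "move MoveLeft (tape_of (b # l) r) = tape_of l (b # r)"
proof -
  show "move MoveRight (tape_of l (a # r)) = tape_of (a # l) r"
  proof
    fix i :: int
    consider "0 \<le> i" | "i = - 1" | "i < - 1" by linarith
    then show "move MoveRight (tape_of l (a # r)) i = tape_of (a # l) r i"
    proof cases
      case 1
      then have "nat (i + 1) = Suc (nat i)" by simp
      then show ?thesis using 1 by (simp add: tape_of_def)
    next
      case 3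
      then have "nat (- i - 1) = Suc (nat (- (i + 1) - 1))" by simp
      then show ?thesis using 3 by (simp add: tape_of_def)
    qed (simp add: tape_of_def)
  qed
  show "move MoveLeft (tape_of (b # l) r) = tape_of l (b # r)"
  proof
    fix i :: int
    consider "1 \<le> i" | "i = 0" | "i < 0" by linarith
    then show "move MoveLeft (tape_of (b # l) r) i = tape_of l (b # r) i"
    proof cases
      case 1
      then have "nat i = Suc (nat (i - 1))" by simp
      then show ?thesis using 1 by (simp add: tape_of_def)
    next
      case 3
      then have "nat (- (i - 1) - 1) = Suc (nat (- i - 1))" by simp
      then show ?thesis using 3 by (simp add: tape_of_def)
    qed (simp add: tape_of_def)
  qed
qed

declare move.simps(1,3) [simp del]

lemma move_left_tape_of_Nil [simp]: "move MoveLeft (tape_of [] r) = tape_of [] (Blank # r)"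
  using move_tape_of(2)[of Blank "[]" r] by simp

lemma move_right_tape_of_Nil [simp]: "move MoveRight (tape_of l []) = tape_of (Blank # l) []"
  using move_tape_of(1)[of l Blank "[]"] by simp

lemma input_tape_eq: "input_tape w = tape_of [] (map Input w)"
  by (auto simp: input_tape_def tape_of_def fun_eq_iff)

lemma blank_tape_eq: "(\<lambda>_. Blank) = tape_of [] []"
  by (simp add: tape_of_def fun_eq_iff)


section \<open>The machine\<close>

text \<open>
  The first tape carries a stack of words with its top at the right end, each word preceded by a
  blank; a word is written from right to left in time order, so that the initial content of the input
  tape, seen from its right end, is a stack with a single entry. The second tape holds
  the word under examination, in time order from left to right.

  In \<open>Fetch\<close> the head of the first tape runs over the input to its end, or steps from the blank
  after the stack to the top word. \<open>Pop c\<close> transfers the top word to the second tape; \<open>c\<close> tells whether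
  a letter was seen, and if none was, the stack is empty and the word is accepted.
  \<open>Fwd x p c\<close> follows a disk from peg \<open>x\<close> through the word: \<open>p\<close> is its present peg and \<open>c\<close> tells
  whether it has been touched. If it does not return to \<open>x\<close>, the word is rejected. \<open>Back x c p\<close> runs
  the disk backwards in time, which is possible because the letters are involutions; if \<open>c\<close>
  holds, the section at \<open>x\<close> is meanwhile pushed onto the stack, and the backward direction is the one
  in which a stacked word has to be written. \<open>Back 0 False 0\<close>, with a dummy peg, only rewinds the second
  tape after a word has been transferred.
\<close>

datatype control = Fetch | Pop bool | Fwd nat nat bool | Back nat bool nat | Accept | Reject

instance control :: countable
  by countable_datatype

definition after_letter :: "nat \<Rightarrow> nat \<Rightarrow> control" where
  "after_letter m x = (if x < m then Fwd (Suc x) (Suc x) False else Fetch)"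

fun hanoi_trans :: "nat \<Rightarrow> control \<Rightarrow> hanoi_state symbol \<Rightarrow> hanoi_state symbol \<Rightarrow>
    control \<times> (hanoi_state symbol \<times> direction) list" where
  "hanoi_trans m Fetch a b = (case a of
      Input s \<Rightarrow> (Fetch, [(a, MoveRight), (b, Stay)])
    | _ \<Rightarrow> (Pop False, [(a, MoveLeft), (b, Stay)]))"
| "hanoi_trans m (Pop c) a b = (case a of
      Input s \<Rightarrow> (Pop True, [(Blank, MoveLeft), (a, MoveRight)])
    | _ \<Rightarrow> if c then (Back 0 False 0, [(a, Stay), (b, MoveLeft)])
           else (Accept, [(a, Stay), (b, Stay)]))"
| "hanoi_trans m (Fwd x p c) a b = (case b of
      Input s \<Rightarrow> (Fwd x (peg_move s p) (c \<or> touches s p), [(a, Stay), (b, MoveRight)])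
    | _ \<Rightarrow> if p = x then (Back x c x, [(a, if c then MoveRight else Stay), (b, MoveLeft)])
           else (Reject, [(a, Stay), (b, Stay)]))"
| "hanoi_trans m (Back x c p) a b = (case b of
      Input s \<Rightarrow> (Back x c (peg_move s p),
                  [if c then (Input (residual s p), MoveRight) else (a, Stay), (b, MoveLeft)])
    | _ \<Rightarrow> (after_letter m x, [(a, Stay), (b, MoveRight)]))"
| "hanoi_trans m Accept a b = (Accept, [(a, Stay), (b, Stay)])"
| "hanoi_trans m Reject a b = (Reject, [(a, Stay), (b, Stay)])"

definition hanoi_controls :: "nat \<Rightarrow> control set" where
  "hanoi_controls m = {Fetch, Pop False, Pop True, Accept, Reject} \<union>
     (\<lambda>(x, p, c). Fwd x p c) ` ({..m} \<times> {..m} \<times> UNIV) \<union>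
     (\<lambda>(x, c, p). Back x c p) ` ({..m} \<times> UNIV \<times> {..m})"

definition hanoi_machine :: "nat \<Rightarrow> (control, hanoi_state) turing_machine" where
  "hanoi_machine m = \<lparr>tapes = 2, states = hanoi_controls m,
     alphabet = insert Blank (Input ` hanoi_states m),
     start = Fetch, accept = Accept, reject = Reject,
     trans = (\<lambda>q r. hanoi_trans m q (r ! 0) (r ! 1))\<rparr>"

lemma hanoi_states_subset_moves_on: "hanoi_states m \<subseteq> moves_on {1..m}"
  by (auto simp: hanoi_states_def moves_on_def)

lemma finite_hanoi_states: "finite (hanoi_states m)"
proof -
  have "hanoi_states m \<subseteq> insert Ident ((\<lambda>(i, j). Transp i j) ` ({..m} \<times> {..m}))"
    by (auto simp: hanoi_states_def image_iff)
  then show ?thesis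
    by (rule finite_subset) simp
qed

lemma peg_move_le: "s \<in> hanoi_states m \<Longrightarrow> p \<le> m \<Longrightarrow> peg_move s p \<le> m"
  by (auto simp: hanoi_states_def)

lemma residual_in_states: "s \<in> hanoi_states m \<Longrightarrow> residual s p \<in> hanoi_states m"
  by (auto simp: hanoi_states_def residual_def)

lemma hanoi_trans_closed:
  assumes "q \<in> hanoi_controls m" "{a, b} \<subseteq> insert Blank (Input ` hanoi_states m)"
    "hanoi_trans m q a b = (q', acts)"
  shows "q' \<in> hanoi_controls m \<and> length acts = 2 \<and>
    set acts \<subseteq> insert Blank (Input ` hanoi_states m) \<times> UNIV"
proof -
  have after: "after_letter m x \<in> hanoi_controls m" for x
    by (auto simp: after_letter_def hanoi_controls_def image_iff)
  have Fwd: "Fwd x p c \<in> hanoi_controls m \<longleftrightarrow> x \<le> m \<and> p \<le> m" for x p c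
    by (auto simp: hanoi_controls_def image_iff)
  have Back: "Back x c p \<in> hanoi_controls m \<longleftrightarrow> x \<le> m \<and> p \<le> m" for x p c
    by (auto simp: hanoi_controls_def image_iff)
  have simple: "Fetch \<in> hanoi_controls m" "Pop c \<in> hanoi_controls m"
      "Accept \<in> hanoi_controls m" "Reject \<in> hanoi_controls m" for c
    by (cases c; simp add: hanoi_controls_def)+
  note closed = after Fwd Back simple peg_move_le residual_in_states
  consider "a = Blank" | s where "s \<in> hanoi_states m" "a = Input s"
    using assms(2) by auto
  note cases_a = this
  consider "b = Blank" | s where "s \<in> hanoi_states m" "b = Input s"
    using assms(2) by auto
  note cases_b = this
  show ?thesis
  proof (cases q)
    case Fetch
    show ?thesis
      using assms(2,3) Fetch by (cases rule: cases_a) (auto simp: closed)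
  next
    case (Pop c)
    show ?thesis
      using assms(2,3) Pop by (cases rule: cases_a) (auto simp: closed split: if_splits)
  next
    case (Fwd x p c)
    show ?thesis
      using assms Fwd by (cases rule: cases_b) (auto simp: closed split: if_splits)
  next
    case (Back x c p)
    show ?thesis
      using assms Back by (cases rule: cases_b) (auto simp: closed split: if_splits)
  qed (use assms in \<open>auto simp: closed\<close>)
qed

lemma hanoi_machine_over: "turing_machine_over (hanoi_states m) (hanoi_machine m)"
proof -
  have "case hanoi_trans m q (r ! 0) (r ! 1) of (q', acts) \<Rightarrow>
      q' \<in> hanoi_controls m \<and> length acts = 2 \<and>
      acts \<in> lists (insert Blank (Input ` hanoi_states m) \<times> UNIV)"
    if "q \<in> hanoi_controls m" "r \<in> lists (insert Blank (Input ` hanoi_states m))" "length r = 2"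
    for q r
  proof -
    have "{r ! 0, r ! 1} \<subseteq> set r"
      using that(3) by simp
    then have "{r ! 0, r ! 1} \<subseteq> insert Blank (Input ` hanoi_states m)"
      using that(2) by blast
    from hanoi_trans_closed[OF that(1) this] show ?thesis
      by (auto simp: lists_eq_set split: prod.split)
  qed
  moreover have "finite (hanoi_controls m)"
    by (simp add: hanoi_controls_def)
  moreover have "{Fetch, Accept, Reject} \<subseteq> hanoi_controls m"
    by (simp add: hanoi_controls_def)
  ultimately show ?thesis
    by (auto simp: turing_machine_over_def hanoi_machine_def finite_hanoi_states)
qed


section \<open>Runs of the machine\<close>

definition stack_symbols :: "hanoi_state list list \<Rightarrow> hanoi_state symbol list" where
  "stack_symbols st = concat (map (\<lambda>u. map Input u @ [Blank]) st)"

lemma stack_symbols_simps [simp]: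
  "stack_symbols [] = []"
  "stack_symbols (u # st) = map Input u @ Blank # stack_symbols st"
  by (simp_all add: stack_symbols_def)

abbreviation hanoi_run ::
  "nat \<Rightarrow> nat \<Rightarrow> control \<times> hanoi_state tape list \<Rightarrow> control \<times> hanoi_state tape list" where
  "hanoi_run m t \<equiv> tm_step (hanoi_machine m) ^^ t"

lemma hanoi_step [simp]:
  "q \<noteq> Accept \<Longrightarrow> q \<noteq> Reject \<Longrightarrow> tm_step (hanoi_machine m) (q, [T, U]) =
     (case hanoi_trans m q (T 0) (U 0) of
       (q', acts) \<Rightarrow> (q', map2 (\<lambda>(a, d) t. move d (t(0 := a))) acts [T, U]))"
  by (simp add: tm_step_def hanoi_machine_def)

lemma hanoi_run_Suc: "hanoi_run m (Suc t) c = hanoi_run m t (tm_step (hanoi_machine m) c)"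
  by (simp add: funpow_Suc_right del: funpow.simps)

lemma hanoi_run_add: "hanoi_run m (t + t') c = hanoi_run m t' (hanoi_run m t c)"
  by (simp add: add.commute[of t] funpow_add)

lemma run_initial_scan:
  "hanoi_run m (length w) (Fetch, [tape_of l (map Input w), U]) =
     (Fetch, [tape_of (rev (map Input w) @ l) [], U])"
proof (induction w arbitrary: l)
  case (Cons s w)
  then show ?case by (simp add: hanoi_run_Suc del: funpow.simps)
qed simp

text \<open>The old content \<open>z\<close> of the second tape is overwritten completely because it is not longer than
  the new word. The head position after a left move from \<open>tape_of l r\<close> is expressed by \<open>move MoveLeft\<close>
  so that the case of an empty list \<open>l\<close> needs no separate treatment.\<close>

lemma run_pop_letters:
  assumes "length z \<le> length u"
  shows "hanoi_run m (Suc (length u))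
      (Pop c, [move MoveLeft (tape_of (map Input u @ L) []), tape_of l (map Input z)]) =
    hanoi_run m 1
      (Pop (c \<or> u \<noteq> []), [move MoveLeft (tape_of L []), tape_of (map Input (rev u) @ l) []])"
  using assms
proof (induction u arbitrary: z l c)
  case (Cons s u)
  have "length (tl z) \<le> length u"
    using Cons.prems by simp
  from Cons.IH[OF this, of True "Input s # l"] show ?case
    by (cases z) (simp_all add: hanoi_run_Suc del: funpow.simps)
qed simp

lemma run_forward:
  "hanoi_run m (length u) (Fwd x p c, [T, tape_of l (map Input u)]) =
     (Fwd x (fold peg_move u p) (c \<or> section_word u p \<noteq> u),
      [T, tape_of (map Input (rev u) @ l) []])"
proof (induction u arbitrary: p c l)
  case (Cons s u)
  have "residual s p = s \<Longrightarrow> peg_move s p = p"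
    by (simp add: residual_eq_iff peg_move_untouched)
  then show ?case
    using Cons[of "peg_move s p" "c \<or> touches s p" "Input s # l"]
    by (auto simp: hanoi_run_Suc residual_eq_iff simp del: funpow.simps)
qed simp

text \<open>The disk enters at the peg where it ends up after \<open>u\<close>, and each letter met on the way back
  undoes its own move. A letter touches the peg before its move iff it touches the peg after it, so
  the section can be read off from either side.\<close>

lemma run_back_pushing:
  "hanoi_run m (length u) (Back x True (fold peg_move u p),
      [tape_of L [], move MoveLeft (tape_of (map Input (rev u)) r)]) =
    (Back x True p, [tape_of (map Input (section_word u p) @ L) [],
      tape_of [] (Blank # map Input u @ r)])"
proof (induction u arbitrary: L r rule: rev_induct)
  case (snoc s u)
  show ?case
    using snoc[of "Input (residual s (fold peg_move u p)) # L" "Input s # r"]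
    by (simp add: hanoi_run_Suc section_word_append del: funpow.simps)
qed simp

lemma run_back_idle:
  "\<exists>p'. hanoi_run m (length u) (Back x False p, [T, move MoveLeft (tape_of (map Input (rev u)) r)]) =
    (Back x False p', [T, tape_of [] (Blank # map Input u @ r)])"
proof (induction u arbitrary: p r rule: rev_induct)
  case (snoc s u)
  show ?case
    using snoc[of "peg_move s p" "Input s # r"]
    by (simp add: hanoi_run_Suc del: funpow.simps)
qed simp


text \<open>The tapes between two passes: the head of the first one is on the blank after the stack, that
  of the second one on the first letter of the word \<open>z\<close>.\<close>

definition work_tapes :: "hanoi_state list list \<Rightarrow> hanoi_state list \<Rightarrow> hanoi_state tape list" where
  "work_tapes st z = [tape_of (stack_symbols st) [], tape_of [] (map Input z)]"

lemma run_pop_word: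
  assumes "u \<noteq> []" "length z \<le> length u"
  shows "hanoi_run m (2 * length u + 3) (Fetch, work_tapes (u # st) z) =
    (after_letter m 0, work_tapes st u)"
proof -
  let ?c = "(Pop False, [move MoveLeft (tape_of (map Input u @ Blank # stack_symbols st) []),
      tape_of [] (map Input z)])"
  have "tm_step (hanoi_machine m) (Fetch, work_tapes (u # st) z) = ?c"
    by (cases z) (simp_all add: work_tapes_def)
  moreover have "hanoi_run m (Suc (length u)) ?c =
      (Back 0 False 0, [tape_of (stack_symbols st) [],
        move MoveLeft (tape_of (map Input (rev u)) [])])"
    using assms(1) by (subst run_pop_letters[OF assms(2)]) simp
  moreover obtain p where "hanoi_run m (length u) (Back 0 False 0, [tape_of (stack_symbols st) [],
        move MoveLeft (tape_of (map Input (rev u)) [])]) =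
      (Back 0 False p, [tape_of (stack_symbols st) [], tape_of [] (Blank # map Input u)])"
    using run_back_idle[of u m 0 0 "tape_of (stack_symbols st) []" "[]"] by auto
  moreover have "tm_step (hanoi_machine m)
      (Back 0 False p, [tape_of (stack_symbols st) [], tape_of [] (Blank # map Input u)]) =
      (after_letter m 0, work_tapes st u)"
    by (simp add: work_tapes_def)
  ultimately have "hanoi_run m (Suc (Suc (length u) + (length u + 1))) (Fetch, work_tapes (u # st) z) =
      (after_letter m 0, work_tapes st u)"
    by (simp only: hanoi_run_Suc hanoi_run_add) simp
  moreover have "Suc (Suc (length u) + (length u + 1)) = 2 * length u + 3"
    by simp
  ultimately show ?thesis by metis
qed

definition child_words :: "hanoi_state list \<Rightarrow> nat \<Rightarrow> hanoi_state list list" where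
  "child_words u x = (if section_word u x = u then [] else [section_word u x])"

lemma run_letter:
  assumes "fold peg_move u x = x"
  shows "hanoi_run m (2 * length u + 2) (Fwd x x False, work_tapes st u) =
    (after_letter m x, work_tapes (child_words u x @ st) u)"
proof -
  define c where "c \<longleftrightarrow> section_word u x \<noteq> u"
  define L where "L = (if c then Blank # stack_symbols st else stack_symbols st)"
  have "hanoi_run m (length u) (Fwd x x False, work_tapes st u) =
      (Fwd x x c, [tape_of (stack_symbols st) [], tape_of (map Input (rev u)) []])"
    using run_forward[of u m x x False] assms by (simp add: work_tapes_def c_def)
  moreover have "tm_step (hanoi_machine m)
        (Fwd x x c, [tape_of (stack_symbols st) [], tape_of (map Input (rev u)) []]) =
      (Back x c x, [tape_of L [], move MoveLeft (tape_of (map Input (rev u)) [])])"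
    by (simp add: L_def)
  moreover obtain p where "hanoi_run m (length u)
        (Back x c x, [tape_of L [], move MoveLeft (tape_of (map Input (rev u)) [])]) =
      (Back x c p, [tape_of (stack_symbols (child_words u x @ st)) [],
        tape_of [] (Blank # map Input u)])"
  proof (cases c)
    case True
    then show ?thesis
      using that[of x] run_back_pushing[of u m x x L "[]"] assms
      by (simp add: L_def child_words_def c_def)
  next
    case False
    then show ?thesis
      using that run_back_idle[of u m x x "tape_of L []" "[]"]
      by (auto simp: L_def child_words_def c_def)
  qed
  moreover have "tm_step (hanoi_machine m)
      (Back x c p, [tape_of (stack_symbols (child_words u x @ st)) [],
        tape_of [] (Blank # map Input u)]) =
      (after_letter m x, work_tapes (child_words u x @ st) u)"
    by (simp add: work_tapes_def)
  ultimately have "hanoi_run m (length u + Suc (length u + 1)) (Fwd x x False, work_tapes st u) =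
      (after_letter m x, work_tapes (child_words u x @ st) u)"
    by (simp only: hanoi_run_Suc hanoi_run_add) simp
  moreover have "length u + Suc (length u + 1) = 2 * length u + 2"
    by simp
  ultimately show ?thesis by metis
qed

lemma run_letter_reject:
  assumes "fold peg_move u x \<noteq> x"
  shows "fst (hanoi_run m (length u + 1) (Fwd x x False, work_tapes st u)) = Reject"
  using run_forward[of u m x x False] assms
  by (simp only: hanoi_run_add) (simp add: work_tapes_def)

definition children :: "hanoi_state list \<Rightarrow> nat \<Rightarrow> hanoi_state list list" where
  "children u k = concat (map (child_words u) (rev [1..<Suc k]))"

lemma children_Suc: "children u (Suc k) = child_words u (Suc k) @ children u k"
  by (simp add: children_def)

lemma length_children: "length (children u k) \<le> k"
  by (induction k) (simp_all add: children_Suc child_words_def, simp add: children_def)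

lemma set_children:
  "set (children u k) = {section_word u x | x. x \<in> {1..k} \<and> section_word u x \<noteq> u}"
  by (auto simp: children_def child_words_def split: if_splits)

text \<open>The letters are processed in increasing order and pushed one above the other, hence the
  decreasing order in \<open>children\<close>.\<close>

lemma run_letters:
  assumes "k \<le> m" "\<forall>x \<in> {1..k}. fold peg_move u x = x"
  shows "hanoi_run m (k * (2 * length u + 2)) (after_letter m 0, work_tapes st u) =
    (after_letter m k, work_tapes (children u k @ st) u)"
  using assms
proof (induction k)
  case 0
  then show ?case by (simp add: children_def)
next
  case (Suc k)
  have start: "after_letter m k = Fwd (Suc k) (Suc k) False"
    using Suc.prems(1) by (simp add: after_letter_def)
  have "hanoi_run m (k * (2 * length u + 2)) (after_letter m 0, work_tapes st u) =
      (Fwd (Suc k) (Suc k) False, work_tapes (children u k @ st) u)"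
    using Suc start by simp
  moreover have "hanoi_run m (2 * length u + 2)
      (Fwd (Suc k) (Suc k) False, work_tapes (children u k @ st) u) =
      (after_letter m (Suc k), work_tapes (children u (Suc k) @ st) u)"
    using run_letter[of u "Suc k"] Suc.prems(2) by (simp add: children_Suc)
  ultimately have "hanoi_run m (k * (2 * length u + 2) + (2 * length u + 2))
      (after_letter m 0, work_tapes st u) =
      (after_letter m (Suc k), work_tapes (children u (Suc k) @ st) u)"
    by (simp only: hanoi_run_add)
  moreover have "k * (2 * length u + 2) + (2 * length u + 2) = Suc k * (2 * length u + 2)"
    by simp
  ultimately show ?case by metis
qed

definition pass_cost :: "nat \<Rightarrow> nat \<Rightarrow> nat" where
  "pass_cost m n = (2 * m + 3) * (n + 1)"

lemma pass_cost_split: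
  assumes "k \<le> m"
  shows "2 * n + 3 + k * (2 * n + 2) \<le> pass_cost m n"
proof -
  have "k * (2 * n + 2) \<le> m * (2 * n + 2)"
    using assms by (rule mult_le_mono1)
  then show ?thesis by (simp add: pass_cost_def algebra_simps)
qed

lemma run_expand:
  assumes "u \<noteq> []" "length z \<le> length u" "\<forall>x \<in> {1..m}. fold peg_move u x = x"
  shows "\<exists>t \<le> pass_cost m (length u).
    hanoi_run m t (Fetch, work_tapes (u # st) z) = (Fetch, work_tapes (children u m @ st) u)"
proof (intro exI conjI)
  show "hanoi_run m (2 * length u + 3 + m * (2 * length u + 2)) (Fetch, work_tapes (u # st) z) =
      (Fetch, work_tapes (children u m @ st) u)"
    unfolding hanoi_run_add[of "2 * length u + 3"] run_pop_word[OF assms(1,2)]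
      run_letters[OF order_refl assms(3)]
    by (simp add: after_letter_def)
qed (rule pass_cost_split[OF order_refl])

lemma run_refute:
  assumes "u \<noteq> []" "length z \<le> length u" "\<not> (\<forall>x \<in> {1..m}. fold peg_move u x = x)"
  shows "\<exists>t \<le> pass_cost m (length u).
    fst (hanoi_run m t (Fetch, work_tapes (u # st) z)) = Reject"
proof -
  \<comment> \<open>The machine stops at the first letter that does not return.\<close>
  define x where "x = (LEAST x. x \<in> {1..m} \<and> fold peg_move u x \<noteq> x)"
  have x: "x \<in> {1..m}" "fold peg_move u x \<noteq> x"
    using LeastI_ex[of "\<lambda>x. x \<in> {1..m} \<and> fold peg_move u x \<noteq> x"] assms(3)
    unfolding x_def by blast+
  then obtain k where k: "x = Suc k" "k < m"
    by (cases x) auto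
  have below: "\<forall>y \<in> {1..k}. fold peg_move u y = y"
    using not_less_Least[of _ "\<lambda>x. x \<in> {1..m} \<and> fold peg_move u x \<noteq> x"] k
    unfolding x_def[symmetric] by (auto simp: less_Suc_eq_le)
  have "k \<le> m" "after_letter m k = Fwd x x False"
    using k by (simp_all add: after_letter_def)
  then have "fst (hanoi_run m ((2 * length u + 3 + k * (2 * length u + 2)) + (length u + 1))
      (Fetch, work_tapes (u # st) z)) = Reject"
    unfolding hanoi_run_add[of "2 * length u + 3 + k * (2 * length u + 2)"]
      hanoi_run_add[of "2 * length u + 3"] run_pop_word[OF assms(1,2)]
      run_letters[OF \<open>k \<le> m\<close> below]
    using run_letter_reject[OF x(2)] by simp
  moreover have "(2 * length u + 3 + k * (2 * length u + 2)) + (length u + 1)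
      \<le> pass_cost m (length u)"
    using pass_cost_split[of "Suc k" m "length u"] k(2) by simp
  ultimately show ?thesis by blast
qed


section \<open>The search tree\<close>

definition fixes_words :: "nat \<Rightarrow> hanoi_state list \<Rightarrow> bool" where
  "fixes_words m u \<longleftrightarrow> (\<forall>v. set v \<subseteq> {1..m} \<longrightarrow> fold hanoi_action u v = v)"

text \<open>If \<open>section_word u x = u\<close>, the disk at \<open>x\<close> rests and testing the section would be testing \<open>u\<close>
  again. Such letters may be skipped: in a position \<open>x # v\<close> the question passes to the shorter
  position \<open>v\<close>, which is why the second direction goes by induction on the position.\<close>

lemma fixes_words_iff:
  "fixes_words m u \<longleftrightarrow> (\<forall>x \<in> {1..m}. fold peg_move u x = x) \<and>
     (\<forall>u' \<in> set (children u m). fixes_words m u')" (is "_ \<longleftrightarrow> ?R")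
proof
  assume fixed: "fixes_words m u"
  have "fold peg_move u x = x \<and> fixes_words m (section_word u x)" if x: "x \<in> {1..m}" for x
  proof -
    have "fold hanoi_action u (x # v) = x # v" if "set v \<subseteq> {1..m}" for v
      using fixed x that by (simp add: fixes_words_def)
    then have *: "fold peg_move u x = x \<and> fold hanoi_action (section_word u x) v = v"
      if "set v \<subseteq> {1..m}" for v
      using that by (simp add: fold_hanoi_action_Cons)
    show ?thesis
      using *[of "[]"] * by (simp add: fixes_words_def)
  qed
  then show ?R
    by (auto simp: set_children)
next
  assume R: ?R
  have "fold hanoi_action u v = v" if "set v \<subseteq> {1..m}" for v
    using that
  proof (induction v)
    case (Cons x v)
    have "fold hanoi_action (section_word u x) v = v"
    proof (cases "section_word u x = u")
      case True
      then show ?thesis using Cons by simp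
    next
      case False
      then have "fixes_words m (section_word u x)"
        using R Cons.prems by (auto simp: set_children)
      then show ?thesis
        using Cons.prems by (simp add: fixes_words_def)
    qed
    then show ?case
      using R Cons.prems by (simp add: fold_hanoi_action_Cons)
  qed simp
  then show "fixes_words m u"
    by (simp add: fixes_words_def)
qed

text \<open>Positions with \<open>moved u v = length v\<close> are exactly the paths that descend from \<open>u\<close> in the search
  tree.\<close>

definition depth_le :: "nat \<Rightarrow> hanoi_state list \<Rightarrow> nat \<Rightarrow> bool" where
  "depth_le m u d \<longleftrightarrow> (\<forall>v. set v \<subseteq> {1..m} \<longrightarrow> moved u v = length v \<longrightarrow> length v \<le> d)"

lemma depth_le_0_children:
  assumes "depth_le m u 0"
  shows "children u m = []"
proof -
  have "section_word u x = u" if "x \<in> {1..m}" for x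
  proof (rule ccontr)
    assume "section_word u x \<noteq> u"
    then show False
      using assms[unfolded depth_le_def, rule_format, of "[x]"] that by simp
  qed
  then have "set (children u m) = {}"
    unfolding set_children by auto
  then show ?thesis
    by simp
qed

lemma depth_le_children:
  assumes "depth_le m u (Suc d)" "u' \<in> set (children u m)"
  shows "depth_le m u' d"
proof -
  obtain x where x: "x \<in> {1..m}" "section_word u x \<noteq> u" "u' = section_word u x"
    using assms(2) by (auto simp: set_children)
  have "length v \<le> d" if "set v \<subseteq> {1..m}" "moved u' v = length v" for v
    using assms(1)[unfolded depth_le_def, rule_format, of "x # v"] that x by simp
  then show ?thesis
    by (simp add: depth_le_def)
qed

text \<open>Starting with the words \<open>us\<close> on top of the stack \<open>st\<close>, \<open>t\<close> steps either remove them with all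
  their descendants or reach rejection, according to whether all of them act trivially. The content
  \<open>z'\<close> left on the second tape must be short enough for the next word to overwrite it.\<close>

definition settles ::
  "nat \<Rightarrow> nat \<Rightarrow> hanoi_state list list \<Rightarrow> hanoi_state list list \<Rightarrow> hanoi_state list \<Rightarrow> nat \<Rightarrow> bool"
  where
  "settles m n us st z t \<longleftrightarrow>
    (if \<forall>u \<in> set us. fixes_words m u
     then \<exists>z'. length z' \<le> n \<and>
       hanoi_run m t (Fetch, work_tapes (us @ st) z) = (Fetch, work_tapes st z')
     else fst (hanoi_run m t (Fetch, work_tapes (us @ st) z)) = Reject)"

lemma settles_list:
  assumes "\<And>u st z. u \<in> set us \<Longrightarrow> length z \<le> n \<Longrightarrow> \<exists>t \<le> C. settles m n [u] st z t"
    and "length z \<le> n"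
  shows "\<exists>t \<le> length us * C. settles m n us st z t"
  using assms
proof (induction us arbitrary: z)
  case Nil
  then show ?case by (intro exI[of _ 0]) (auto simp: settles_def)
next
  case (Cons u us)
  have "\<exists>t \<le> C. settles m n [u] (us @ st) z t"
    using Cons.prems by simp
  then obtain t where t: "t \<le> C" "settles m n [u] (us @ st) z t"
    by blast
  show ?case
  proof (cases "fixes_words m u")
    case False
    then have "settles m n (u # us) st z t"
      using t(2) by (simp add: settles_def)
    then show ?thesis
      using t(1) by (intro exI[of _ t]) simp
  next
    case True
    then obtain z' where z': "length z' \<le> n"
        "hanoi_run m t (Fetch, work_tapes (u # us @ st) z) = (Fetch, work_tapes (us @ st) z')"
      using t(2) by (auto simp: settles_def)
    have "\<exists>t' \<le> length us * C. settles m n us st z' t'"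
      using Cons.IH[OF _ z'(1)] Cons.prems(1) by simp
    then obtain t' where t': "t' \<le> length us * C" "settles m n us st z' t'"
      by blast
    have "hanoi_run m (t + t') (Fetch, work_tapes ((u # us) @ st) z) =
        hanoi_run m t' (Fetch, work_tapes (us @ st) z')"
      using z'(2) by (simp add: hanoi_run_add)
    then have "settles m n (u # us) st z (t + t')"
      using t'(2) True by (simp add: settles_def)
    then show ?thesis
      using t(1) t'(1) by (intro exI[of _ "t + t'"]) simp
  qed
qed

lemma settles_word:
  assumes "u \<noteq> []" "length u = n" "length z \<le> n"
    and "\<exists>t \<le> C. settles m n (children u m) st u t"
  shows "\<exists>t \<le> pass_cost m n + C. settles m n [u] st z t"
proof (cases "\<forall>x \<in> {1..m}. fold peg_move u x = x")
  case True
  obtain t where t: "t \<le> pass_cost m n"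
      "hanoi_run m t (Fetch, work_tapes (u # st) z) = (Fetch, work_tapes (children u m @ st) u)"
    using run_expand[OF assms(1) _ True, of z st] assms(2,3) by blast
  obtain t' where t': "t' \<le> C" "settles m n (children u m) st u t'"
    using assms(4) by blast
  have "fixes_words m u \<longleftrightarrow> (\<forall>u' \<in> set (children u m). fixes_words m u')"
    using fixes_words_iff[of m u] True by blast
  then have "settles m n [u] st z (t + t')"
    using t'(2) t(2) by (simp add: settles_def hanoi_run_add)
  then show ?thesis
    using t(1) t'(1) by (intro exI[of _ "t + t'"]) simp
next
  case False
  obtain t where t: "t \<le> pass_cost m n"
      "fst (hanoi_run m t (Fetch, work_tapes (u # st) z)) = Reject"
    using run_refute[OF assms(1) _ False, of z st] assms(2,3) by blast
  have "\<not> fixes_words m u"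
    using fixes_words_iff[of m u] False by blast
  then have "settles m n [u] st z t"
    using t(2) by (simp add: settles_def)
  then show ?thesis
    using t(1) by (intro exI[of _ t]) simp
qed

text \<open>A word costs one pass plus the costs of its at most \<open>m\<close> children, and
  \<open>1 + m * (m + 1) ^ d \<le> (m + 1) ^ Suc d\<close>.\<close>

lemma settles_bounded_depth:
  assumes "n \<noteq> 0" "length u = n" "depth_le m u d" "length z \<le> n"
  shows "\<exists>t \<le> pass_cost m n * (m + 1) ^ d. settles m n [u] st z t"
  using assms(2-4)
proof (induction d arbitrary: u st z)
  case 0
  have "settles m n (children u m) st u 0"
    using depth_le_0_children[OF 0(2)] 0(1) by (auto simp: settles_def)
  then show ?case
    using settles_word[of u n z 0 m st] 0 \<open>n \<noteq> 0\<close> by fastforce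
next
  case (Suc d)
  let ?C = "pass_cost m n * (m + 1) ^ d"
  have "\<exists>t \<le> ?C. settles m n [u'] st z t"
    if "u' \<in> set (children u m)" "length z \<le> n" for u' st z
    using Suc.IH[of u' z st] depth_le_children[OF Suc.prems(2)] that Suc.prems(1)
    by (auto simp: set_children)
  then obtain t where "t \<le> length (children u m) * ?C" "settles m n (children u m) st u t"
    using settles_list[of "children u m" n ?C m u st] Suc.prems(1) by auto
  moreover have "length (children u m) * ?C \<le> m * ?C"
    by (rule mult_le_mono1[OF length_children])
  ultimately have "\<exists>t \<le> m * ?C. settles m n (children u m) st u t"
    using order_trans by blast
  then have "\<exists>t \<le> pass_cost m n + m * ?C. settles m n [u] st z t"
    using Suc.prems \<open>n \<noteq> 0\<close> by (intro settles_word) auto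
  moreover have "pass_cost m n + m * ?C \<le> pass_cost m n * (m + 1) ^ Suc d"
  proof -
    have "pass_cost m n * 1 \<le> ?C"
      by (rule mult_le_mono2) simp
    then show ?thesis by (simp add: algebra_simps)
  qed
  ultimately show ?case
    using order_trans by blast
qed

lemma run_accept: "fst (hanoi_run m 2 (Fetch, work_tapes [] z)) = Accept"
  by (cases z) (simp_all add: work_tapes_def numeral_2_eq_2 hanoi_run_Suc del: funpow.simps(2))

lemma run_init:
  "hanoi_run m (length w) (tm_init (hanoi_machine m) w) =
     (Fetch, work_tapes (if w = [] then [] else [rev w]) [])"
  using run_initial_scan[of w m "[]" "tape_of [] []"]
  by (auto simp: tm_init_def hanoi_machine_def input_tape_eq blank_tape_eq work_tapes_def rev_map
      simp del: funpow.simps)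

lemma fixes_words_rev_iff:
  assumes "w \<in> lists (hanoi_states m)"
  shows "fixes_words m (rev w) \<longleftrightarrow> w \<in> hanoi_word_problem m"
  using assms by (auto simp: hanoi_word_problem_iff fixes_words_def foldr_conv_fold hanoi_words_def
      lists_eq_set)

theorem hanoi_machine_decides:
  assumes "w \<in> lists (hanoi_states m)" "depth_le m (rev w) d"
  shows "\<exists>t \<le> length w + pass_cost m (length w) * (m + 1) ^ d + 2.
    fst (hanoi_run m t (tm_init (hanoi_machine m) w)) =
      (if w \<in> hanoi_word_problem m then Accept else Reject)"
proof (cases "w = []")
  case True
  have "fst (hanoi_run m (length w + 2) (tm_init (hanoi_machine m) w)) = Accept"
    unfolding hanoi_run_add run_init using True run_accept by simp
  moreover have "w \<in> hanoi_word_problem m"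
    using True by (simp add: hanoi_word_problem_iff)
  ultimately show ?thesis
    by (intro exI[of _ "length w + 2"]) simp
next
  case False
  obtain t where t: "t \<le> pass_cost m (length w) * (m + 1) ^ d"
      "settles m (length w) [rev w] [] [] t"
    using settles_bounded_depth[of "length w" "rev w" m d "[]" "[]"] False assms(2) by auto
  have init: "hanoi_run m (length w + t') (tm_init (hanoi_machine m) w) =
      hanoi_run m t' (Fetch, work_tapes [rev w] [])" for t'
    unfolding hanoi_run_add run_init using False by simp
  show ?thesis
  proof (cases "w \<in> hanoi_word_problem m")
    case True
    then obtain z' where "hanoi_run m t (Fetch, work_tapes [rev w] []) = (Fetch, work_tapes [] z')"
      using t(2) fixes_words_rev_iff[OF assms(1)] by (auto simp: settles_def)
    then have "fst (hanoi_run m (length w + (t + 2)) (tm_init (hanoi_machine m) w)) = Accept"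
      unfolding init hanoi_run_add[of t] by (simp add: run_accept del: funpow.simps)
    then show ?thesis
      using t(1) True by (intro exI[of _ "length w + (t + 2)"]) simp
  next
    case no: False
    then have "fst (hanoi_run m (length w + t) (tm_init (hanoi_machine m) w)) = Reject"
      unfolding init using t(2) fixes_words_rev_iff[OF assms(1)] by (simp add: settles_def)
    then show ?thesis
      using t(1) no by (intro exI[of _ "length w + t"]) simp
  qed
qed

section \<open>Numbering the states of a machine\<close>

definition number_states :: "('q :: countable, 's) turing_machine \<Rightarrow> (nat, 's) turing_machine" where
  "number_states M = \<lparr>tapes = tapes M, states = to_nat ` states M, alphabet = alphabet M,
     start = to_nat (start M), accept = to_nat (accept M), reject = to_nat (reject M),
     trans = (\<lambda>q r. apfst to_nat (trans M (from_nat q) r))\<rparr>"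

lemma turing_machine_over_number_states:
  assumes "turing_machine_over S M"
  shows "turing_machine_over S (number_states M)"
proof -
  have "case apfst to_nat (trans M q r) of (q', acts) \<Rightarrow>
      q' \<in> to_nat ` states M \<and> length acts = tapes M \<and> acts \<in> lists (alphabet M \<times> UNIV)"
    if "q \<in> states M" "r \<in> lists (alphabet M)" "length r = tapes M" for q r
    using assms that unfolding turing_machine_over_def by (cases "trans M q r") fastforce
  then show ?thesis
    using assms by (simp add: turing_machine_over_def number_states_def)
qed

lemma run_number_states:
  "(tm_step (number_states M) ^^ t) (tm_init (number_states M) w) =
     apfst to_nat ((tm_step M ^^ t) (tm_init M w))"
proof (induction t)
  case 0
  show ?case by (simp add: tm_init_def number_states_def)
next
  case (Suc t)
  have "tm_step (number_states M) (apfst to_nat c) = apfst to_nat (tm_step M c)" for c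
    by (cases c) (simp add: tm_step_def number_states_def split: prod.split)
  then show ?case
    using Suc by simp
qed

lemma decides_in_time_number_states:
  assumes "decides_in_time M S L T"
  shows "decides_in_time (number_states M) S L T"
  unfolding decides_in_time_def
proof (intro conjI ballI)
  show "turing_machine_over S (number_states M)"
    using assms by (simp add: decides_in_time_def turing_machine_over_number_states)
  fix w
  assume "w \<in> lists S"
  then obtain t where t: "real t \<le> T (length w)"
      "fst ((tm_step M ^^ t) (tm_init M w)) = (if w \<in> L then accept M else reject M)"
    using assms unfolding decides_in_time_def by blast
  have "fst ((tm_step (number_states M) ^^ t) (tm_init (number_states M) w)) =
      (if w \<in> L then accept (number_states M) else reject (number_states M))"
    unfolding run_number_states by (simp add: t(2) number_states_def)
  then show "\<exists>t. real t \<le> T (length w) \<and>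
      fst ((tm_step (number_states M) ^^ t) (tm_init (number_states M) w)) =
        (if w \<in> L then accept (number_states M) else reject (number_states M))"
    using t(1) by blast
qed


section \<open>The running time\<close>

definition bit_length :: "nat \<Rightarrow> nat" where
  "bit_length n = nat \<lceil>log 2 (real n + 1)\<rceil>"

lemma less_two_power_bit_length: "n < 2 ^ bit_length n"
proof -
  have "log 2 (real n + 1) \<le> real (bit_length n)"
    unfolding bit_length_def by linarith
  then have "real n + 1 \<le> 2 powr real (bit_length n)"
    by (subst (asm) log_le_iff) auto
  then have "real (n + 1) \<le> real (2 ^ bit_length n)"
    by (simp add: powr_realpow)
  then show ?thesis
    unfolding of_nat_le_iff by simp
qed

definition search_time :: "nat \<Rightarrow> nat \<Rightarrow> nat" where
  "search_time m n = n + pass_cost m n * (m + 1) ^ ((3 * bit_length n) ^ (m - 2)) + 2"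

lemma search_time_pos: "0 < search_time m n"
  by (simp add: search_time_def)

lemma hanoi_machine_in_time:
  assumes "m \<ge> 2"
  shows "decides_in_time (hanoi_machine m) (hanoi_states m) (hanoi_word_problem m)
    (\<lambda>n. real (search_time m n))"
proof -
  have "\<exists>t::nat. real t \<le> real (search_time m (length w)) \<and>
      fst (hanoi_run m t (tm_init (hanoi_machine m) w)) =
        (if w \<in> hanoi_word_problem m then Accept else Reject)"
    if w: "w \<in> lists (hanoi_states m)" for w
  proof -
    have "moved (rev w) v \<le> (3 * bit_length (length w)) ^ (m - 2)" for v
    proof (rule moved_disks_bound)
      show "card {1..m} = m - 2 + 2"
        using assms by simp
      show "set (rev w) \<subseteq> moves_on {1..m}"
        using w hanoi_states_subset_moves_on[of m] by (auto simp: lists_eq_set)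
      show "length (rev w) < 2 ^ bit_length (length w)"
        using less_two_power_bit_length by simp
    qed
    then have "depth_le m (rev w) ((3 * bit_length (length w)) ^ (m - 2))"
      unfolding depth_le_def by metis
    from hanoi_machine_decides[OF w this] show ?thesis
      unfolding search_time_def of_nat_le_iff by blast
  qed
  moreover have "accept (hanoi_machine m) = Accept" "reject (hanoi_machine m) = Reject"
    by (simp_all add: hanoi_machine_def)
  ultimately show ?thesis
    unfolding decides_in_time_def using hanoi_machine_over[of m] by metis
qed

text \<open>The time is a polynomial factor times \<open>(m + 1) ^ D\<close> with \<open>D = (3 * bit_length n) ^ (m - 2)\<close>. For
  \<open>L = ln n\<close> and \<open>n \<ge> 2\<close> the estimate \<open>ln 2 \<ge> 1 / 2\<close> gives \<open>2 * L \<ge> 1\<close>, which absorbs constants and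
  lets \<open>2 * L\<close> be bounded by \<open>(2 * L) ^ (m - 2)\<close>; this is where \<open>m \<ge> 3\<close> enters. The constant 18 is
  three times the 6 in \<open>bit_length n \<le> 6 * L\<close>.\<close>

lemma ln_search_time_le:
  assumes "m \<ge> 3" "n \<ge> 2"
  shows "ln (real (search_time m n)) \<le>
    (ln (2 * real m + 5) * 2 ^ (m - 2) + 2 ^ (m - 2) + ln (real m + 1) * 18 ^ (m - 2)) *
      ln (real n) ^ (m - 2)"
proof -
  define L where "L = ln (real n)"
  define k where "k = m - 2"
  define D where "D = (3 * bit_length n) ^ k"
  have k: "k \<ge> 1"
    using assms(1) by (simp add: k_def)
  have ln2: "1 / 2 \<le> ln (2 :: real)"
    using ln_le_minus_one[of "1 / 2 :: real"] by (simp add: ln_div)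
  have "ln 2 \<le> L"
    unfolding L_def using assms(2) by simp
  then have L: "1 / 2 \<le> L"
    using ln2 by linarith
  have one: "1 \<le> (2 * L) ^ k"
    using L by (intro one_le_power) simp
  have twoL: "2 * L \<le> (2 * L) ^ k"
    using L k by (intro self_le_power) auto
  have "ln (real n + 1) \<le> ln (real n ^ 2)"
  proof -
    have "real n + 1 \<le> 2 * real n"
      using assms(2) by simp
    also have "\<dots> \<le> real n * real n"
      using assms(2) by (intro mult_right_mono) auto
    finally show ?thesis
      using assms(2) by (simp add: power2_eq_square)
  qed
  also have "\<dots> = 2 * L"
    using assms(2) by (simp add: L_def ln_realpow)
  finally have ln_n: "ln (real n + 1) \<le> 2 * L" .
  have "log 2 (real n + 1) \<le> 4 * L"
  proof -
    have "log 2 (real n + 1) = ln (real n + 1) / ln 2"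
      by (simp add: log_def)
    also have "\<dots> \<le> 2 * L / (1 / 2)"
      using ln_n ln2 L by (intro frac_le) auto
    finally show ?thesis by simp
  qed
  then have "real (bit_length n) \<le> 6 * L"
    unfolding bit_length_def using L by linarith
  then have "(3 * real (bit_length n)) ^ k \<le> (18 * L) ^ k"
    by (intro power_mono) auto
  then have D: "real D \<le> 18 ^ k * L ^ k"
    by (simp add: D_def power_mult_distrib)
  have "search_time m n \<le> (2 * m + 5) * (n + 1) * (m + 1) ^ D"
  proof -
    have "n + 2 \<le> 2 * (n + 1) * 1"
      by simp
    also have "\<dots> \<le> 2 * (n + 1) * (m + 1) ^ D"
      by (rule mult_le_mono2) simp
    finally show ?thesis
      by (simp add: search_time_def pass_cost_def D_def k_def algebra_simps)
  qed
  then have "real (search_time m n) \<le> (2 * real m + 5) * (real n + 1) * (real m + 1) ^ D"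
    by (metis (mono_tags, lifting) of_nat_le_iff of_nat_add of_nat_mult of_nat_numeral of_nat_1
        of_nat_power)
  moreover have "0 < real (search_time m n)"
    using search_time_pos by simp
  ultimately have "ln (real (search_time m n)) \<le>
      ln ((2 * real m + 5) * (real n + 1) * (real m + 1) ^ D)"
    by (subst ln_le_cancel_iff) auto
  also have "\<dots> = ln (2 * real m + 5) + ln (real n + 1) + real D * ln (real m + 1)"
    by (simp add: ln_mult ln_realpow)
  also have "\<dots> \<le> ln (2 * real m + 5) * (2 * L) ^ k + (2 * L) ^ k +
      18 ^ k * L ^ k * ln (real m + 1)"
  proof (intro add_mono)
    show "ln (2 * real m + 5) \<le> ln (2 * real m + 5) * (2 * L) ^ k"
      using mult_left_mono[OF one, of "ln (2 * real m + 5)"] by simp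
    show "ln (real n + 1) \<le> (2 * L) ^ k"
      using ln_n twoL by linarith
    show "real D * ln (real m + 1) \<le> 18 ^ k * L ^ k * ln (real m + 1)"
      using D by (rule mult_right_mono) simp
  qed
  also have "\<dots> = (ln (2 * real m + 5) * 2 ^ k + 2 ^ k + ln (real m + 1) * 18 ^ k) * L ^ k"
    by (simp add: algebra_simps power_mult_distrib)
  finally show ?thesis
    unfolding k_def L_def .
qed

theorem corollary1p2:
  fixes m :: nat
  assumes "m \<ge> 3"
  shows "\<exists>(M :: (nat, hanoi_state) turing_machine) (f :: nat \<Rightarrow> real).
    f \<in> O(\<lambda>n. ln (real n) ^ (m - 2)) \<and>
    decides_in_time M (hanoi_states m) (hanoi_word_problem m) (\<lambda>n. exp (f n))"
proof (intro exI conjI)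
  show "(\<lambda>n. ln (real (search_time m n))) \<in> O(\<lambda>n. ln (real n) ^ (m - 2))"
  proof (rule bigoI[OF eventually_mono[OF eventually_ge_at_top[of 2]]])
    fix n :: nat
    assume "2 \<le> n"
    then have "0 \<le> ln (real (search_time m n))" "0 \<le> ln (real n) ^ (m - 2)"
      using search_time_pos[of m n] by simp_all
    then show "norm (ln (real (search_time m n))) \<le>
        (ln (2 * real m + 5) * 2 ^ (m - 2) + 2 ^ (m - 2) + ln (real m + 1) * 18 ^ (m - 2)) *
          norm (ln (real n) ^ (m - 2))"
      using ln_search_time_le[OF assms \<open>2 \<le> n\<close>] by simp
  qed
  have "exp (ln (real (search_time m n))) = real (search_time m n)" for n
    using search_time_pos[of m n] by simp
  then show "decides_in_time (number_states (hanoi_machine m)) (hanoi_states m)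
      (hanoi_word_problem m) (\<lambda>n. exp (ln (real (search_time m n))))"
    using decides_in_time_number_states[OF hanoi_machine_in_time[of m]] assms by simp
qed

end
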